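(* For every CRWL-program $\mathcal R$ over a signature $\Sigma$, the CRWL-term algebra $\mathcal M_{\mathcal R}$ is the least fixpoint (and the least pre-fixpoint) of the operator $\mathcal T_{\mathcal R}:\mathbf{TAlg}_\Sigma\to\mathbf{TAlg}_\Sigma$.
   Context: Terms. $\Sigma=(DS_\Sigma,FS_\Sigma)$ consists of countable disjoint sets of constructor symbols and of (defined) function symbols, each with an arity; $DS^n_\Sigma$, $FS^n_\Sigma$ are the symbols of arity $n\ge 0$. $\mathcal V$ is a countable set of variables; $\bot$ is an extra 0-ary constructor. $\mathbf{Term}_\bot$ is the set of terms over $DS_\Sigma\cup FS_\Sigma\cup\{\bot\}$ and $\mathcal V$; $\mathbf{CTerm}_\bot$ is the subset of terms without function symbols; $\mathbf{Term}$, $\mathbf{CTerm}$ are the respective subsets of terms not containing $\bot$. $\mathbf{CSubst}_\bot$ is the set of maps $\theta:\mathcal V\to\mathbf{CTerm}_\bot$, extended to terms and written $t\theta$. Formulas are reduction statements $a\to b$ and joinability statements $a\bowtie b$ with $a,b\in\mathbf{Term}_\bot$. $\sqsubseteq$ is the least partial order on $\mathbf{CTerm}_\bot$ with $\bot\sqsubseteq t$ and $c(\overline s)\sqsubseteq c(\overline t)$ whenever $c\in DS^n_\Sigma$ and $s_i\sqsubseteq t_i$ for all $i$; $\langle t\rangle=\{s\in\mathbf{CTerm}_\bot\mid s\sqsubseteq t\}$. A cone is a non-empty subset of $\mathbf{CTerm}_\bot$ closed downwards under $\sqsubseteq$. Programs. A CRWL-program is a set $\mathcal R$ of rules $f(\overline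 t)\to r\Leftarrow C$ with $f\in FS^n_\Sigma$, $\overline t$ an $n$-tuple of terms of $\mathbf{CTerm}$ in which no variable occurs twice, $r$ a term, and $C$ a finite set of joinability statements between terms of $\mathbf{Term}$. $[\mathcal R]_\bot$ is the set of all instances $(l\to r\Leftarrow C)\theta$ of rules of $\mathcal R$ with $\theta\in\mathbf{CSubst}_\bot$. Provability. $\mathcal R\vdash_{CRWL}\varphi$ means $\varphi$ is derivable with: (Bo) $e\to\bot$ for $e\in\mathbf{Term}_\bot$; (RR) $e\to e$ for $e\in\mathcal V\cup DS^0_\Sigma$; (DS) from $e_i\to t_i$ ($1\le i\le n$) infer $c(\overline e)\to c(\overline t)$, for $c\in DS^n_\Sigma$; (OR) from $e_i\to t_i$ ($1\le i\le n$), all statements of $C$, and $r\to t$ infer $f(\overline e)\to t$, if $(f(\overline t)\to r\Leftarrow C)\in[\mathcal R]_\bot$ and $t\neq\bot$; (Jo) from $a\to t$ and $b\to t$ infer $a\bowtie b$, if $t\in\mathbf{CTerm}$. Term algebras. A CRWL-term algebra $\mathcal A$ of signature $\Sigma$ has carrier $\mathbf{CTerm}_\bot$, interprets each $c\in DS^n_\Sigma$ by $c^{\mathcal A}(\overline t)=\langle c(\overline t)\rangle$, and each $f\in FS^n_\Sigma$ by a monotonic map $f^{\mathcal A}$ from $(\mathbf{CTerm}_\bot)^n$ to cones ordered by inclusion (a cone if $n=0$). $\mathbf{TAlg}_\Sigma$ is the set of them, ordered by $\mathcal A\sqsubseteq\mathcal B$ iff $f^{\mathcal A}(\overline t)\subseteq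 f^{\mathcal B}(\overline t)$ for all $f$ and $\overline t$. A valuation is a map $\eta:\mathcal V\to\mathbf{CTerm}_\bot$. Evaluation: $[\![\bot]\!]^{\mathcal A}_\eta=\langle\bot\rangle$, $[\![X]\!]^{\mathcal A}_\eta=\langle\eta(X)\rangle$, and $[\![h(e_1,\dots,e_n)]\!]^{\mathcal A}_\eta=\bigcup\{h^{\mathcal A}(u_1,\dots,u_n)\mid u_i\in[\![e_i]\!]^{\mathcal A}_\eta\}$ for $h\in DS^n_\Sigma\cup FS^n_\Sigma$. $id$ is the identity valuation. $\mathcal A\models_\eta a\bowtie b$ iff $[\![a]\!]^{\mathcal A}_\eta\cap[\![b]\!]^{\mathcal A}_\eta$ contains a maximal element of $\mathbf{CTerm}_\bot$ (i.e. an element of $\mathbf{CTerm}$); $\mathcal A\models_\eta C$ iff this holds for every statement of $C$. $\mathcal M_{\mathcal R}$ is the term algebra with $f^{\mathcal M_{\mathcal R}}(\overline t)=\{r\in\mathbf{CTerm}_\bot\mid\mathcal R\vdash_{CRWL}f(\overline t)\to r\}$ for $f\in FS^n_\Sigma$, $t_i\in\mathbf{CTerm}_\bot$. $\mathcal T_{\mathcal R}$ is defined by $f^{\mathcal T_{\mathcal R}(\mathcal A)}(\overline t)=\{t\mid\exists(f(\overline s)\to r\Leftarrow C)\in[\mathcal R]_\bot,\ s_i\sqsubseteq t_i\text{ for all }i,\ \mathcal A\models_{id}C,\ t\in[\![r]\!]^{\mathcal A}_{id}\}\cup\{\bot\}$. A pre-fixpoint of $\mathcal T_{\mathcal R}$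 is an $\mathcal A$ with $\mathcal T_{\mathcal R}(\mathcal A)\sqsubseteq\mathcal A$. *)

theory Defs
  imports Main "HOL-Library.FuncSet" "HOL-Library.Countable_Set"
begin

text \<open>Constructor symbols and function symbols live in two different types, so the two sets of a
  signature are disjoint by typing. The extra constructor \<open>Bot\<close> is not a member of \<open>DS\<close>.\<close>

record ('c, 'f) signature =
  DS :: "'c set"
  FS :: "'f set"
  ar_con :: "'c \<Rightarrow> nat"
  ar_fun :: "'f \<Rightarrow> nat"

definition is_signature :: "('c, 'f) signature \<Rightarrow> bool" where
  "is_signature \<Sigma> \<longleftrightarrow> countable (DS \<Sigma>) \<and> countable (FS \<Sigma>)"

datatype (con_syms: 'c, fun_syms: 'f, vars: 'v) trm =
    Var 'v
  | Bot
  | Con 'c "('c, 'f, 'v) trm list"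
  | Fun 'f "('c, 'f, 'v) trm list"

primrec has_bot :: "('c, 'f, 'v) trm \<Rightarrow> bool" where
  "has_bot (Var x) = False"
| "has_bot Bot = True"
| "has_bot (Con c ts) = list_ex (\<lambda>b. b) (map has_bot ts)"
| "has_bot (Fun f ts) = list_ex (\<lambda>b. b) (map has_bot ts)"

text \<open>Variable occurrences from left to right, with repetitions.\<close>

primrec var_occs :: "('c, 'f, 'v) trm \<Rightarrow> 'v list" where
  "var_occs (Var x) = [x]"
| "var_occs Bot = []"
| "var_occs (Con c ts) = concat (map var_occs ts)"
| "var_occs (Fun f ts) = concat (map var_occs ts)"

primrec subst :: "('v \<Rightarrow> ('c, 'f, 'v) trm) \<Rightarrow> ('c, 'f, 'v) trm \<Rightarrow> ('c, 'f, 'v) trm" where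
  "subst \<theta> (Var x) = \<theta> x"
| "subst \<theta> Bot = Bot"
| "subst \<theta> (Con c ts) = Con c (map (subst \<theta>) ts)"
| "subst \<theta> (Fun f ts) = Fun f (map (subst \<theta>) ts)"

text \<open>A suffix \<open>B\<close> stands for the subscript \<open>\<bottom>\<close>.\<close>

inductive_set TermB :: "('c, 'f) signature \<Rightarrow> ('c, 'f, 'v) trm set"
  for \<Sigma> :: "('c, 'f) signature" where
  Var: "Var x \<in> TermB \<Sigma>"
| Bot: "Bot \<in> TermB \<Sigma>"
| Con: "c \<in> DS \<Sigma> \<Longrightarrow> length ts = ar_con \<Sigma> c \<Longrightarrow> \<forall>t\<in>set ts. t \<in> TermB \<Sigma> \<Longrightarrow> Con c ts \<in> TermB \<Sigma>"
| Fun: "f \<in> FS \<Sigma> \<Longrightarrow> length ts = ar_fun \<Sigma> f \<Longrightarrow> \<forall>t\<in>set ts. t \<in> TermB \<Sigma> \<Longrightarrow> Fun f ts \<in> TermB \<Sigma>"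

definition CTermB :: "('c, 'f) signature \<Rightarrow> ('c, 'f, 'v) trm set" where
  "CTermB \<Sigma> = {t \<in> TermB \<Sigma>. fun_syms t = {}}"

definition Term :: "('c, 'f) signature \<Rightarrow> ('c, 'f, 'v) trm set" where
  "Term \<Sigma> = {t \<in> TermB \<Sigma>. \<not> has_bot t}"

definition CTerm :: "('c, 'f) signature \<Rightarrow> ('c, 'f, 'v) trm set" where
  "CTerm \<Sigma> = {t \<in> CTermB \<Sigma>. \<not> has_bot t}"

definition CSubstB :: "('c, 'f) signature \<Rightarrow> ('v \<Rightarrow> ('c, 'f, 'v) trm) set" where
  "CSubstB \<Sigma> = {\<theta>. \<forall>x. \<theta> x \<in> CTermB \<Sigma>}"

text \<open>The least preorder with the two closure properties. It is antisymmetric, hence the least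
  partial order with them: see \<open>approx_partial_order\<close> and \<open>approx_least\<close> below.\<close>

inductive approx :: "('c, 'f) signature \<Rightarrow> ('c, 'f, 'v) trm \<Rightarrow> ('c, 'f, 'v) trm \<Rightarrow> bool"
  for \<Sigma> :: "('c, 'f) signature" where
  refl: "t \<in> CTermB \<Sigma> \<Longrightarrow> approx \<Sigma> t t"
| trans: "approx \<Sigma> s t \<Longrightarrow> approx \<Sigma> t u \<Longrightarrow> approx \<Sigma> s u"
| bot: "t \<in> CTermB \<Sigma> \<Longrightarrow> approx \<Sigma> Bot t"
| con: "c \<in> DS \<Sigma> \<Longrightarrow> length ss = ar_con \<Sigma> c \<Longrightarrow> list_all2 (approx \<Sigma>) ss ts
    \<Longrightarrow> approx \<Sigma> (Con c ss) (Con c ts)"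

definition down :: "('c, 'f) signature \<Rightarrow> ('c, 'f, 'v) trm \<Rightarrow> ('c, 'f, 'v) trm set" where
  "down \<Sigma> t = {s \<in> CTermB \<Sigma>. approx \<Sigma> s t}"

definition cones :: "('c, 'f) signature \<Rightarrow> ('c, 'f, 'v) trm set set" where
  "cones \<Sigma> = {K. K \<noteq> {} \<and> K \<subseteq> CTermB \<Sigma> \<and>
     (\<forall>t\<in>K. \<forall>s\<in>CTermB \<Sigma>. approx \<Sigma> s t \<longrightarrow> s \<in> K)}"

definition is_maximal :: "('c, 'f) signature \<Rightarrow> ('c, 'f, 'v) trm \<Rightarrow> bool" where
  "is_maximal \<Sigma> t \<longleftrightarrow> t \<in> CTermB \<Sigma> \<and> (\<forall>s\<in>CTermB \<Sigma>. approx \<Sigma> t s \<longrightarrow> s = t)"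

text \<open>\<open>Rule f ts r C\<close> is the rule \<open>f(ts) \<rightarrow> r \<Leftarrow> C\<close>; a pair \<open>(a, b)\<close> in \<open>C\<close> is the
  joinability statement \<open>a \<bowtie> b\<close>.\<close>

datatype ('c, 'f, 'v) rule =
  Rule 'f "('c, 'f, 'v) trm list" "('c, 'f, 'v) trm" "(('c, 'f, 'v) trm \<times> ('c, 'f, 'v) trm) set"

text \<open>Extra variables in \<open>r\<close> and \<open>C\<close> are allowed, and so are infinite programs.\<close>

definition is_program :: "('c, 'f) signature \<Rightarrow> ('c, 'f, 'v) rule set \<Rightarrow> bool" where
  "is_program \<Sigma> \<R> \<longleftrightarrow> (\<forall>f ts r C. Rule f ts r C \<in> \<R> \<longrightarrow>
     f \<in> FS \<Sigma> \<and> length ts = ar_fun \<Sigma> f \<and> set ts \<subseteq> CTerm \<Sigma> \<and>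
     distinct (concat (map var_occs ts)) \<and>
     r \<in> TermB \<Sigma> \<and> finite C \<and> C \<subseteq> Term \<Sigma> \<times> Term \<Sigma>)"

definition instances :: "('c, 'f) signature \<Rightarrow> ('c, 'f, 'v) rule set \<Rightarrow> ('c, 'f, 'v) rule set" where
  "instances \<Sigma> \<R> =
     {Rule f (map (subst \<theta>) ts) (subst \<theta> r) ((\<lambda>(a, b). (subst \<theta> a, subst \<theta> b)) ` C) | f ts r C \<theta>.
        Rule f ts r C \<in> \<R> \<and> \<theta> \<in> CSubstB \<Sigma>}"

datatype ('c, 'f, 'v) formula =
    Red "('c, 'f, 'v) trm" "('c, 'f, 'v) trm"
  | Join "('c, 'f, 'v) trm" "('c, 'f, 'v) trm"

inductive crwl :: "('c, 'f) signature \<Rightarrow> ('c, 'f, 'v) rule set \<Rightarrow> ('c, 'f, 'v) formula \<Rightarrow> bool"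
  for \<Sigma> :: "('c, 'f) signature" and \<R> :: "('c, 'f, 'v) rule set" where
  Bo: "e \<in> TermB \<Sigma> \<Longrightarrow> crwl \<Sigma> \<R> (Red e Bot)"
| RR: "e \<in> range Var \<union> {Con c [] | c. c \<in> DS \<Sigma> \<and> ar_con \<Sigma> c = 0} \<Longrightarrow> crwl \<Sigma> \<R> (Red e e)"
| DS: "c \<in> DS \<Sigma> \<Longrightarrow> length es = ar_con \<Sigma> c \<Longrightarrow> list_all2 (\<lambda>e t. crwl \<Sigma> \<R> (Red e t)) es ts
    \<Longrightarrow> crwl \<Sigma> \<R> (Red (Con c es) (Con c ts))"
| OR: "Rule f ts r C \<in> instances \<Sigma> \<R> \<Longrightarrow> list_all2 (\<lambda>e t. crwl \<Sigma> \<R> (Red e t)) es ts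
    \<Longrightarrow> (\<And>a b. (a, b) \<in> C \<Longrightarrow> crwl \<Sigma> \<R> (Join a b)) \<Longrightarrow> crwl \<Sigma> \<R> (Red r t) \<Longrightarrow> t \<noteq> Bot
    \<Longrightarrow> crwl \<Sigma> \<R> (Red (Fun f es) t)"
| Jo: "crwl \<Sigma> \<R> (Red a t) \<Longrightarrow> crwl \<Sigma> \<R> (Red b t) \<Longrightarrow> t \<in> CTerm \<Sigma> \<Longrightarrow> crwl \<Sigma> \<R> (Join a b)"

text \<open>The carrier of a term algebra and its interpretation of the constructor symbols are fixed, so
  an algebra is given by its interpretation of the function symbols. Interpretations are
  extensional (\<open>undefined\<close> outside \<open>FS\<close> and outside tuples of the right length over \<open>CTermB\<close>), so
  that HOL equality of two members of \<open>TAlg\<close> is equality of algebras.\<close>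

type_synonym ('c, 'f, 'v) algebra = "'f \<Rightarrow> ('c, 'f, 'v) trm list \<Rightarrow> ('c, 'f, 'v) trm set"

definition args :: "('c, 'f) signature \<Rightarrow> 'f \<Rightarrow> ('c, 'f, 'v) trm list set" where
  "args \<Sigma> f = {ts. length ts = ar_fun \<Sigma> f \<and> set ts \<subseteq> CTermB \<Sigma>}"

definition con_interp ::
  "('c, 'f) signature \<Rightarrow> 'c \<Rightarrow> ('c, 'f, 'v) trm list \<Rightarrow> ('c, 'f, 'v) trm set" where
  "con_interp \<Sigma> c ts = down \<Sigma> (Con c ts)"

definition TAlg :: "('c, 'f) signature \<Rightarrow> ('c, 'f, 'v) algebra set" where
  "TAlg \<Sigma> = {A \<in> (\<Pi>\<^sub>E f\<in>FS \<Sigma>. args \<Sigma> f \<rightarrow>\<^sub>E cones \<Sigma>).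
     \<forall>f\<in>FS \<Sigma>. \<forall>ss\<in>args \<Sigma> f. \<forall>ts\<in>args \<Sigma> f. list_all2 (approx \<Sigma>) ss ts \<longrightarrow> A f ss \<subseteq> A f ts}"

definition alg_le ::
  "('c, 'f) signature \<Rightarrow> ('c, 'f, 'v) algebra \<Rightarrow> ('c, 'f, 'v) algebra \<Rightarrow> bool" where
  "alg_le \<Sigma> A B \<longleftrightarrow> (\<forall>f\<in>FS \<Sigma>. \<forall>ts\<in>args \<Sigma> f. A f ts \<subseteq> B f ts)"

primrec eval :: "('c, 'f) signature \<Rightarrow> ('c, 'f, 'v) algebra \<Rightarrow> ('v \<Rightarrow> ('c, 'f, 'v) trm)
    \<Rightarrow> ('c, 'f, 'v) trm \<Rightarrow> ('c, 'f, 'v) trm set" where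
  "eval \<Sigma> A \<eta> (Var x) = down \<Sigma> (\<eta> x)"
| "eval \<Sigma> A \<eta> Bot = down \<Sigma> Bot"
| "eval \<Sigma> A \<eta> (Con c es) =
     \<Union> {con_interp \<Sigma> c us | us. list_all2 (\<in>) us (map (eval \<Sigma> A \<eta>) es)}"
| "eval \<Sigma> A \<eta> (Fun f es) =
     \<Union> {A f us | us. list_all2 (\<in>) us (map (eval \<Sigma> A \<eta>) es)}"

definition models :: "('c, 'f) signature \<Rightarrow> ('c, 'f, 'v) algebra \<Rightarrow> ('v \<Rightarrow> ('c, 'f, 'v) trm)
    \<Rightarrow> (('c, 'f, 'v) trm \<times> ('c, 'f, 'v) trm) set \<Rightarrow> bool" where
  "models \<Sigma> A \<eta> C \<longleftrightarrow>
     (\<forall>(a, b)\<in>C. \<exists>t. t \<in> eval \<Sigma> A \<eta> a \<inter> eval \<Sigma> A \<eta> b \<and> is_maximal \<Sigma> t)"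

definition M_alg :: "('c, 'f) signature \<Rightarrow> ('c, 'f, 'v) rule set \<Rightarrow> ('c, 'f, 'v) algebra" where
  "M_alg \<Sigma> \<R> = (\<lambda>f\<in>FS \<Sigma>. \<lambda>ts\<in>args \<Sigma> f. {r \<in> CTermB \<Sigma>. crwl \<Sigma> \<R> (Red (Fun f ts) r)})"

text \<open>\<open>Var\<close> is the identity valuation.\<close>

definition T_op ::
  "('c, 'f) signature \<Rightarrow> ('c, 'f, 'v) rule set \<Rightarrow> ('c, 'f, 'v) algebra \<Rightarrow> ('c, 'f, 'v) algebra" where
  "T_op \<Sigma> \<R> A = (\<lambda>f\<in>FS \<Sigma>. \<lambda>ts\<in>args \<Sigma> f.
     {t. \<exists>ss r C. Rule f ss r C \<in> instances \<Sigma> \<R> \<and> list_all2 (approx \<Sigma>) ss ts \<and>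
           models \<Sigma> A Var C \<and> t \<in> eval \<Sigma> A Var r} \<union> {Bot})"

lemma Con_CTermB:
  "Con c ts \<in> CTermB \<Sigma> \<longleftrightarrow> c \<in> DS \<Sigma> \<and> length ts = ar_con \<Sigma> c \<and> set ts \<subseteq> CTermB \<Sigma>"
  by (auto simp: CTermB_def intro: TermB.intros elim: TermB.cases)

lemma approx_CTermB: "approx \<Sigma> s t \<Longrightarrow> s \<in> CTermB \<Sigma> \<and> t \<in> CTermB \<Sigma>"
proof (induction rule: approx.induct)
  case (bot t)
  then show ?case by (simp add: CTermB_def TermB.Bot)
next
  case (con c ss ts)
  then show ?case
    by (auto simp: Con_CTermB list_all2_conv_all_nth in_set_conv_nth)
qed auto

lemma approx_cases:
  "approx \<Sigma> s t \<Longrightarrow> s = Bot \<or> s = t \<or>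
     (\<exists>c ss ts. s = Con c ss \<and> t = Con c ts \<and> list_all2 (approx \<Sigma>) ss ts)"
proof (induction rule: approx.induct)
  case (trans s t u)
  consider "s = Bot \<or> s = t \<or> t = Bot \<or> t = u"
    | c xs ys zs where "s = Con c xs" "t = Con c ys" "u = Con c zs"
        "list_all2 (approx \<Sigma>) xs ys" "list_all2 (approx \<Sigma>) ys zs"
    using trans.IH by fastforce
  then show ?case
  proof cases
    case 1
    then show ?thesis using trans.IH by blast
  next
    case 2
    then have "list_all2 (approx \<Sigma>) xs zs"
      unfolding list_all2_conv_all_nth by (metis approx.trans)
    then show ?thesis using 2 by blast
  qed
next
  case (con c ss ts)
  then have "list_all2 (approx \<Sigma>) ss ts" by (simp add: list_all2_conv_all_nth)
  then show ?case by blast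
qed auto

lemma approx_antisym: "approx \<Sigma> s t \<Longrightarrow> approx \<Sigma> t s \<Longrightarrow> s = t"
proof (induction s arbitrary: t)
  case (Con c ss)
  show ?case
  proof (cases "Con c ss = t")
    case False
    then obtain ts where t: "t = Con c ts" and le: "list_all2 (approx \<Sigma>) ss ts"
      using approx_cases[OF Con.prems(1)] by auto
    then have ge: "list_all2 (approx \<Sigma>) ts ss"
      using approx_cases[OF Con.prems(2)] False by auto
    have "ss = ts"
      using le ge Con.IH by (auto intro!: nth_equalityI simp: list_all2_conv_all_nth)
    then show ?thesis using t by simp
  qed
qed (auto dest: approx_cases)

lemma approx_partial_order: "partial_order_on (CTermB \<Sigma>) {(s, t). approx \<Sigma> s t}"
proof -
  have "{(s, t). approx \<Sigma> s t} \<subseteq> CTermB \<Sigma> \<times> CTermB \<Sigma>"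
    using approx_CTermB by blast
  moreover have "refl_on (CTermB \<Sigma>) {(s, t). approx \<Sigma> s t}"
    by (simp add: refl_on_def approx.refl)
  moreover have "Relation.trans {(s, t). approx \<Sigma> s t}"
    unfolding trans_def using approx.trans by blast
  moreover have "antisym {(s, t). approx \<Sigma> s t}"
    unfolding antisym_def using approx_antisym by blast
  ultimately show ?thesis
    by (simp add: partial_order_on_def preorder_on_def)
qed

lemma approx_least:
  assumes "partial_order_on (CTermB \<Sigma>) Q"
    and "\<And>t. t \<in> CTermB \<Sigma> \<Longrightarrow> (Bot, t) \<in> Q"
    and "\<And>c ss ts. c \<in> DS \<Sigma> \<Longrightarrow> length ss = ar_con \<Sigma> c \<Longrightarrow> list_all2 (\<lambda>s t. (s, t) \<in> Q) ss ts
      \<Longrightarrow> (Con c ss, Con c ts) \<in> Q"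
    and "approx \<Sigma> s t"
  shows "(s, t) \<in> Q"
  using assms(4)
proof (induction rule: approx.induct)
  case (refl t)
  have "refl_on (CTermB \<Sigma>) Q" using assms(1) by (simp add: partial_order_on_def preorder_on_def)
  then show ?case using refl by (rule refl_onD)
next
  case (trans s t u)
  have "Relation.trans Q" using assms(1) by (simp add: partial_order_on_def preorder_on_def)
  then show ?case using trans.IH by (rule transD)
next
  case (bot t)
  then show ?case by (rule assms(2))
next
  case (con c ss ts)
  have "list_all2 (\<lambda>s t. (s, t) \<in> Q) ss ts"
    using con.IH by (simp add: list_all2_conv_all_nth)
  with con.hyps show ?case by (rule assms(3))
qed

lemma CTerm_approx_eq: "t \<in> CTerm \<Sigma> \<Longrightarrow> approx \<Sigma> t s \<Longrightarrow> s = t"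
proof (induction t arbitrary: s)
  case (Con c ts)
  show ?case
  proof (cases "Con c ts = s")
    case False
    then obtain us where s: "s = Con c us" and le: "list_all2 (approx \<Sigma>) ts us"
      using approx_cases[OF Con.prems(2)] by auto
    have "t \<in> CTerm \<Sigma>" if "t \<in> set ts" for t
      using Con.prems(1) that by (auto simp: CTerm_def Con_CTermB list_ex_iff)
    then have "us = ts"
      using le Con.IH by (auto intro!: nth_equalityI simp: list_all2_conv_all_nth)
    then show ?thesis using s by simp
  qed simp
qed (auto simp: CTerm_def CTermB_def dest: approx_cases)

lemma bot_not_maximal: "t \<in> CTermB \<Sigma> \<Longrightarrow> has_bot t \<Longrightarrow> \<exists>s. approx \<Sigma> t s \<and> s \<noteq> t"
proof (induction t)
  case Bot
  have "approx \<Sigma> Bot (Var undefined)"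
    by (rule approx.bot) (simp add: CTermB_def TermB.Var)
  then show ?case by blast
next
  case (Con c ts)
  have ts: "c \<in> DS \<Sigma>" "length ts = ar_con \<Sigma> c" "set ts \<subseteq> CTermB \<Sigma>"
    using Con.prems(1) by (simp_all add: Con_CTermB)
  obtain i where i: "i < length ts" "has_bot (ts ! i)"
    using Con.prems(2) by (auto simp: list_ex_iff in_set_conv_nth)
  have mem: "ts ! j \<in> CTermB \<Sigma>" if "j < length ts" for j
    using ts(3) nth_mem[OF that] by (rule subsetD)
  obtain s where s: "approx \<Sigma> (ts ! i) s" "s \<noteq> ts ! i"
    using Con.IH[OF nth_mem[OF i(1)] mem[OF i(1)] i(2)] by blast
  have "approx \<Sigma> (ts ! j) (ts[i := s] ! j)" if "j < length ts" for j
    using s(1) mem[OF that] that by (cases "j = i") (simp_all add: approx.refl)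
  then have "list_all2 (approx \<Sigma>) ts (ts[i := s])"
    by (simp add: list_all2_conv_all_nth)
  with ts(1,2) have "approx \<Sigma> (Con c ts) (Con c (ts[i := s]))" by (rule approx.con)
  moreover have "ts[i := s] \<noteq> ts"
    using s(2) i(1) nth_list_update_eq[of i ts s] by force
  ultimately show ?case by blast
qed (simp_all add: CTermB_def)

lemma is_maximal_iff_CTerm: "is_maximal \<Sigma> t \<longleftrightarrow> t \<in> CTerm \<Sigma>"
proof
  assume "is_maximal \<Sigma> t"
  then show "t \<in> CTerm \<Sigma>"
    using bot_not_maximal[of t \<Sigma>] by (auto simp: is_maximal_def CTerm_def dest: approx_CTermB)
next
  assume "t \<in> CTerm \<Sigma>"
  then show "is_maximal \<Sigma> t"
    using CTerm_approx_eq by (auto simp: is_maximal_def CTerm_def)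
qed

end

theory Submission imports Defs begin

text \<open>On constructor terms, provability of \<open>s \<rightarrow> u\<close> is just \<open>u \<sqsubseteq> s\<close>. Hence every argument of a
  defined function can be reduced to a constructor term first, and denotations in \<open>M_alg\<close> are
  exactly the sets of provable reducts: \<open>t \<in> \<lbrakk>e\<rbrakk>\<close> iff \<open>e \<rightarrow> t\<close>. With this the defining equation
  of the operator at \<open>M_alg\<close> is rule OR read in both directions. Leastness is soundness of the
  calculus in any pre-fixpoint, by induction on derivations.\<close>

section \<open>Well-formed terms, substitution instances and the approximation order\<close>

lemma Con_TermB:
  "Con c ts \<in> TermB \<Sigma> \<longleftrightarrow> c \<in> DS \<Sigma> \<and> length ts = ar_con \<Sigma> c \<and> set ts \<subseteq> TermB \<Sigma>"
  by (auto intro: TermB.intros elim: TermB.cases)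

lemma Fun_TermB:
  "Fun f ts \<in> TermB \<Sigma> \<longleftrightarrow> f \<in> FS \<Sigma> \<and> length ts = ar_fun \<Sigma> f \<and> set ts \<subseteq> TermB \<Sigma>"
  by (auto intro: TermB.intros elim: TermB.cases)

lemma Var_CTermB [simp]: "Var x \<in> CTermB \<Sigma>"
  by (simp add: CTermB_def TermB.Var)

lemma Bot_CTermB [simp]: "Bot \<in> CTermB \<Sigma>"
  by (simp add: CTermB_def TermB.Bot)

lemma Fun_CTermB [simp]: "Fun f ts \<notin> CTermB \<Sigma>"
  by (simp add: CTermB_def)

lemma CTermB_TermB: "t \<in> CTermB \<Sigma> \<Longrightarrow> t \<in> TermB \<Sigma>"
  by (simp add: CTermB_def)

lemma subst_CTermB:
  assumes "\<theta> \<in> CSubstB \<Sigma>" and "t \<in> CTermB \<Sigma>"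
  shows "subst \<theta> t \<in> CTermB \<Sigma>"
  using assms(2)
proof (induction t)
  case (Var x)
  then show ?case using assms(1) by (simp add: CSubstB_def)
qed (auto simp: Con_CTermB)

lemma subst_TermB:
  assumes "\<theta> \<in> CSubstB \<Sigma>" and "t \<in> TermB \<Sigma>"
  shows "subst \<theta> t \<in> TermB \<Sigma>"
  using assms(2)
proof (induction t)
  case (Var x)
  then show ?case using assms(1) by (simp add: CSubstB_def CTermB_def)
qed (auto simp: Con_TermB Fun_TermB TermB.Bot)

lemma approx_Bot_iff [simp]: "approx \<Sigma> t Bot \<longleftrightarrow> t = Bot"
  by (auto dest: approx_cases intro: approx.refl)

lemma approx_Var_iff: "approx \<Sigma> t (Var x) \<longleftrightarrow> t = Bot \<or> t = Var x"
  by (auto dest: approx_cases intro: approx.refl approx.bot)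

lemma approx_refl_list: "set ts \<subseteq> CTermB \<Sigma> \<Longrightarrow> list_all2 (approx \<Sigma>) ts ts"
  by (auto simp: list_all2_same intro: approx.refl)

lemma approx_trans_list:
  "list_all2 (approx \<Sigma>) xs ys \<Longrightarrow> list_all2 (approx \<Sigma>) ys zs \<Longrightarrow> list_all2 (approx \<Sigma>) xs zs"
  by (rule list_all2_trans[OF approx.trans])

lemma approx_Con_iff:
  assumes "Con c ts \<in> CTermB \<Sigma>"
  shows "approx \<Sigma> t (Con c ts) \<longleftrightarrow> t = Bot \<or> (\<exists>ss. t = Con c ss \<and> list_all2 (approx \<Sigma>) ss ts)"
proof -
  have "list_all2 (approx \<Sigma>) ts ts"
    using assms by (simp add: Con_CTermB approx_refl_list)
  moreover have "approx \<Sigma> (Con c ss) (Con c ts)" if "list_all2 (approx \<Sigma>) ss ts" for ss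
    using assms that list_all2_lengthD[OF that] by (simp add: Con_CTermB approx.con)
  ultimately show ?thesis
    using assms by (auto dest!: approx_cases intro: approx.bot)
qed

text \<open>Substituting constructor terms for variables keeps the patterns free of function
  symbols, so they can serve as arguments in a term algebra. The substitution may introduce
  \<open>Bot\<close>; hence conditions over \<open>Term\<close> become conditions over
  \<open>TermB\<close>.\<close>

lemma instance_TermB:
  assumes "is_program \<Sigma> \<R>" and "Rule f ts r C \<in> instances \<Sigma> \<R>"
  shows "f \<in> FS \<Sigma>" and "ts \<in> args \<Sigma> f" and "r \<in> TermB \<Sigma>" and "C \<subseteq> TermB \<Sigma> \<times> TermB \<Sigma>"
proof -
  obtain ts' r' C' \<theta> where eq: "ts = map (subst \<theta>) ts'" "r = subst \<theta> r'"
      "C = (\<lambda>(a, b). (subst \<theta> a, subst \<theta> b)) ` C'"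
    and R: "Rule f ts' r' C' \<in> \<R>" and \<theta>: "\<theta> \<in> CSubstB \<Sigma>"
    using assms(2) by (auto simp: instances_def)
  have P: "f \<in> FS \<Sigma>" "length ts' = ar_fun \<Sigma> f" "set ts' \<subseteq> CTerm \<Sigma>" "r' \<in> TermB \<Sigma>"
      "C' \<subseteq> Term \<Sigma> \<times> Term \<Sigma>"
    using assms(1) R unfolding is_program_def by blast+
  show "f \<in> FS \<Sigma>" by (fact P)
  show "ts \<in> args \<Sigma> f"
    using P eq subst_CTermB[OF \<theta>] by (auto simp: args_def CTerm_def)
  show "r \<in> TermB \<Sigma>" using P eq subst_TermB[OF \<theta>] by simp
  show "C \<subseteq> TermB \<Sigma> \<times> TermB \<Sigma>"
    using P(5) eq subst_TermB[OF \<theta>] by (auto simp: Term_def)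
qed

section \<open>The calculus: inversion, downward closure and the factoring of function calls\<close>

inductive_cases crwl_VarE: "crwl \<Sigma> \<R> (Red (Var x) t)"
inductive_cases crwl_BotE: "crwl \<Sigma> \<R> (Red Bot t)"
inductive_cases crwl_ConE: "crwl \<Sigma> \<R> (Red (Con c es) t)"
inductive_cases crwl_FunE: "crwl \<Sigma> \<R> (Red (Fun f es) t)"
inductive_cases crwl_JoinE: "crwl \<Sigma> \<R> (Join a b)"

lemma crwl_Con_cases:
  assumes "crwl \<Sigma> \<R> (Red (Con c es) t)"
  obtains "t = Bot"
  | ts where "t = Con c ts" "c \<in> DS \<Sigma>" "length es = ar_con \<Sigma> c"
      "list_all2 (\<lambda>e t. crwl \<Sigma> \<R> (Red e t)) es ts"
  using assms by (elim crwl_ConE) auto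

text \<open>Right-hand sides of provable reductions are built by \<open>Bo\<close>,
  \<open>RR\<close> and \<open>DS\<close> only, while \<open>OR\<close> passes on the one of its
  last premise; so no function symbol ever enters them.\<close>

lemma crwl_Red_TermB:
  assumes "is_program \<Sigma> \<R>" and "crwl \<Sigma> \<R> (Red e t)"
  shows "e \<in> TermB \<Sigma>" and "t \<in> CTermB \<Sigma>"
proof -
  \<comment> \<open>Reductions and joinability statements are derived by one inductive predicate, so
    the induction needs a claim about every formula; joinability gets the trivial one.\<close>
  have "case \<phi> of Red e t \<Rightarrow> e \<in> TermB \<Sigma> \<and> t \<in> CTermB \<Sigma> | Join a b \<Rightarrow> True"
    if "crwl \<Sigma> \<R> \<phi>" for \<phi>
    using that
  proof (induction rule: crwl.induct)
    case (OR f ts r C es t)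
    have "es ! i \<in> TermB \<Sigma>" if "i < length es" for i
      using OR.IH(1) that by (auto simp: list_all2_conv_all_nth)
    moreover have "length es = ar_fun \<Sigma> f"
      using OR.IH(1) instance_TermB(2)[OF assms(1) OR.hyps(1)]
      by (auto simp: args_def dest: list_all2_lengthD)
    ultimately show ?case
      using OR.IH(3) instance_TermB(1)[OF assms(1) OR.hyps(1)]
      by (auto simp: Fun_TermB in_set_conv_nth)
  qed (auto simp: Con_TermB Con_CTermB TermB.Var in_set_conv_nth list_all2_conv_all_nth)
  from this[OF assms(2)] show "e \<in> TermB \<Sigma>" "t \<in> CTermB \<Sigma>" by simp_all
qed

text \<open>A derivation of a reduction can stop early: wherever the smaller target has
  \<open>Bot\<close>, the corresponding subderivation is replaced by \<open>Bo\<close>. Under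
  \<open>OR\<close> only the premise on the right-hand side of the rule changes.\<close>

lemma crwl_down_closed:
  assumes "is_program \<Sigma> \<R>" and "crwl \<Sigma> \<R> (Red e t)" and "approx \<Sigma> s t"
  shows "crwl \<Sigma> \<R> (Red e s)"
proof -
  have "case \<phi> of Red e t \<Rightarrow> \<forall>s. approx \<Sigma> s t \<longrightarrow> crwl \<Sigma> \<R> (Red e s) | Join a b \<Rightarrow> True"
    if "crwl \<Sigma> \<R> \<phi>" for \<phi>
    using that
  proof (induction rule: crwl.induct)
    case (Bo e)
    then show ?case by (auto intro: crwl.Bo)
  next
    case (RR e)
    \<comment> \<open>A variable or a constant has nothing below it but \<open>Bot\<close> and
      itself.\<close>
    have "s = Bot \<or> s = e" if "approx \<Sigma> s e" for s
      using approx_cases[OF that] RR by auto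
    moreover have "e \<in> TermB \<Sigma>" using RR by (auto simp: Con_TermB TermB.Var)
    ultimately show ?case using RR by (auto intro: crwl.RR crwl.Bo)
  next
    case (DS c es ts)
    have red: "crwl \<Sigma> \<R> (Red (Con c es) (Con c ts))"
      using DS by (auto intro!: crwl.DS elim!: list_all2_mono)
    have "crwl \<Sigma> \<R> (Red (Con c es) s)" if le: "approx \<Sigma> s (Con c ts)" for s
    proof -
      have "Con c ts \<in> CTermB \<Sigma>" using le approx_CTermB by blast
      with le consider "s = Bot" | ss where "s = Con c ss" "list_all2 (approx \<Sigma>) ss ts"
        by (auto simp: approx_Con_iff)
      then show ?thesis
      proof cases
        case 1
        then show ?thesis using crwl_Red_TermB(1)[OF assms(1) red] by (simp add: crwl.Bo)
      next
        case 2
        have "list_all2 (\<lambda>e s. crwl \<Sigma> \<R> (Red e s)) es ss"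
          using DS.IH 2(2) by (simp add: list_all2_conv_all_nth)
        then show ?thesis using DS.hyps 2(1) by (simp add: crwl.DS)
      qed
    qed
    then show ?case by simp
  next
    case (OR f ts r C es t)
    have es: "list_all2 (\<lambda>e t. crwl \<Sigma> \<R> (Red e t)) es ts"
      using OR.IH(1) by (auto elim!: list_all2_mono)
    have red: "crwl \<Sigma> \<R> (Red (Fun f es) t)"
      using OR.hyps es by (auto intro: crwl.OR)
    have "crwl \<Sigma> \<R> (Red (Fun f es) s)" if "approx \<Sigma> s t" for s
    \<comment> \<open>The rule \<open>OR\<close> excludes the target \<open>Bot\<close>, which is
      left to \<open>Bo\<close>.\<close>
    proof (cases "s = Bot")
      case True
      then show ?thesis using crwl_Red_TermB(1)[OF assms(1) red] by (simp add: crwl.Bo)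
    next
      case False
      then show ?thesis using OR.hyps OR.IH(3) es that by (auto intro: crwl.OR)
    qed
    then show ?case by simp
  qed simp
  from this[OF assms(2)] assms(3) show ?thesis by simp
qed

lemma crwl_CTermB_refl: "t \<in> CTermB \<Sigma> \<Longrightarrow> crwl \<Sigma> \<R> (Red t t)"
proof (induction t)
  case (Con c ts)
  then have "list_all2 (\<lambda>e t. crwl \<Sigma> \<R> (Red e t)) ts ts"
    by (auto simp: Con_CTermB list_all2_same)
  then show ?case using Con.prems by (simp add: Con_CTermB crwl.DS)
qed (auto intro: crwl.RR crwl.Bo TermB.Bot)

text \<open>Without function symbols \<open>OR\<close> never applies, so a derivation can only copy
  \<open>s\<close> or cut subterms down to \<open>Bot\<close>. Conversely, \<open>s\<close> reduces
  to itself, and downward closure gives everything below it.\<close>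

lemma crwl_CTermB_iff:
  assumes "is_program \<Sigma> \<R>" and "s \<in> CTermB \<Sigma>"
  shows "crwl \<Sigma> \<R> (Red s u) \<longleftrightarrow> approx \<Sigma> u s"
proof
  assume "crwl \<Sigma> \<R> (Red s u)"
  then show "approx \<Sigma> u s"
    using assms(2)
  proof (induction s arbitrary: u)
    case (Con c es)
    from Con.prems(1) show ?case
    proof (cases rule: crwl_Con_cases)
      case 1
      then show ?thesis using Con.prems(2) by (simp add: approx.bot)
    next
      case (2 ts)
      have "list_all2 (approx \<Sigma>) ts es"
        using 2(4) Con.IH Con.prems(2)
        by (auto simp: list_all2_conv_all_nth Con_CTermB subset_iff)
      then show ?thesis using 2(1) Con.prems(2) by (simp add: approx_Con_iff)
    qed
  qed (auto elim: crwl_VarE crwl_BotE simp: approx_Var_iff)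
next
  assume "approx \<Sigma> u s"
  then show "crwl \<Sigma> \<R> (Red s u)"
    using crwl_down_closed[OF assms(1) crwl_CTermB_refl[OF assms(2)]] by simp
qed

text \<open>The side condition \<open>t \<noteq> Bot\<close> of \<open>OR\<close> dissolves into the
  first disjunct: for that target \<open>Bo\<close> suffices, and it asks for the well-formedness of
  the call.\<close>

lemma crwl_Fun_iff:
  assumes "is_program \<Sigma> \<R>" and "Fun f es \<in> TermB \<Sigma>"
  shows "crwl \<Sigma> \<R> (Red (Fun f es) t) \<longleftrightarrow> t = Bot \<or>
    (\<exists>ts r C. Rule f ts r C \<in> instances \<Sigma> \<R> \<and> list_all2 (\<lambda>e t. crwl \<Sigma> \<R> (Red e t)) es ts \<and>
      (\<forall>(a, b)\<in>C. crwl \<Sigma> \<R> (Join a b)) \<and> crwl \<Sigma> \<R> (Red r t))"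
  using assms(2) by (cases "t = Bot") (auto intro: crwl.Bo elim!: crwl_FunE intro: crwl.OR, blast)

text \<open>On constructor arguments the premises for the arguments turn into the matching condition
  \<open>list_all2 (approx \<Sigma>) ss ts\<close>, which brings \<open>OR\<close> into the shape of
  the set in \<open>T_op_def\<close>.\<close>

lemma crwl_Fun_args_iff:
  assumes "is_program \<Sigma> \<R>" and "ts \<in> args \<Sigma> f" and "f \<in> FS \<Sigma>"
  shows "crwl \<Sigma> \<R> (Red (Fun f ts) t) \<longleftrightarrow> t = Bot \<or>
    (\<exists>ss r C. Rule f ss r C \<in> instances \<Sigma> \<R> \<and> list_all2 (approx \<Sigma>) ss ts \<and>
      (\<forall>(a, b)\<in>C. crwl \<Sigma> \<R> (Join a b)) \<and> crwl \<Sigma> \<R> (Red r t))"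
proof -
  have ts: "length ts = ar_fun \<Sigma> f" "set ts \<subseteq> CTermB \<Sigma>"
    using assms(2) by (simp_all add: args_def)
  have "Fun f ts \<in> TermB \<Sigma>"
    using ts assms(3) by (auto simp: Fun_TermB CTermB_TermB)
  moreover have "list_all2 (\<lambda>e t. crwl \<Sigma> \<R> (Red e t)) ts ss \<longleftrightarrow> list_all2 (approx \<Sigma>) ss ts" for ss
    using ts(2) by (auto simp: list_all2_conv_all_nth crwl_CTermB_iff[OF assms(1)] subset_iff)
  ultimately show ?thesis by (simp add: crwl_Fun_iff[OF assms(1)])
qed

text \<open>Call-time choice: the arguments can be evaluated to constructor terms before the call.
  This is the proof-theoretic counterpart of the union over \<open>us\<close> in the evaluation of
  \<open>Fun f es\<close>.\<close>

lemma crwl_Fun_via_CTermB: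
  assumes "is_program \<Sigma> \<R>" and "Fun f es \<in> TermB \<Sigma>"
  shows "crwl \<Sigma> \<R> (Red (Fun f es) t) \<longleftrightarrow>
    (\<exists>us. list_all2 (\<lambda>u e. crwl \<Sigma> \<R> (Red e u)) us es \<and> crwl \<Sigma> \<R> (Red (Fun f us) t))"
proof
  have f: "f \<in> FS \<Sigma>" and es: "length es = ar_fun \<Sigma> f" "set es \<subseteq> TermB \<Sigma>"
    using assms(2) by (simp_all add: Fun_TermB)
  {
    assume red: "crwl \<Sigma> \<R> (Red (Fun f es) t)"
    show "\<exists>us. list_all2 (\<lambda>u e. crwl \<Sigma> \<R> (Red e u)) us es \<and> crwl \<Sigma> \<R> (Red (Fun f us) t)"
    proof (cases "t = Bot")
      case True
      \<comment> \<open>The target \<open>Bot\<close> may come from \<open>Bo\<close> with no rule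
        instance behind it, so the trivial reducts of the arguments are used.\<close>
      let ?us = "replicate (length es) Bot"
      have "list_all2 (\<lambda>u e. crwl \<Sigma> \<R> (Red e u)) ?us es"
        using es(2) by (auto simp: list_all2_conv_all_nth intro!: crwl.Bo)
      moreover have "Fun f ?us \<in> TermB \<Sigma>"
        using f es by (auto simp: Fun_TermB TermB.Bot)
      ultimately show ?thesis using True crwl.Bo by blast
    next
      case False
      then obtain ts r C where R: "Rule f ts r C \<in> instances \<Sigma> \<R>"
        and ts: "list_all2 (\<lambda>e t. crwl \<Sigma> \<R> (Red e t)) es ts"
        and rest: "\<forall>(a, b)\<in>C. crwl \<Sigma> \<R> (Join a b)" "crwl \<Sigma> \<R> (Red r t)"
        using red by (auto simp: crwl_Fun_iff[OF assms])
      \<comment> \<open>The patterns \<open>ts\<close> of the instance are themselves the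
        intermediate constructor terms: \<open>es\<close> reduces to them, and the same instance
        applies to them by reflexivity of \<sqsubseteq>.\<close>
      note args = instance_TermB(2)[OF assms(1) R]
      then have "list_all2 (approx \<Sigma>) ts ts" by (simp add: args_def approx_refl_list)
      with R rest have "crwl \<Sigma> \<R> (Red (Fun f ts) t)"
        using crwl_Fun_args_iff[OF assms(1) args f] by blast
      moreover have "list_all2 (\<lambda>u e. crwl \<Sigma> \<R> (Red e u)) ts es"
        using ts by (simp add: list_all2_conv_all_nth)
      ultimately show ?thesis by blast
    qed
  }
  assume "\<exists>us. list_all2 (\<lambda>u e. crwl \<Sigma> \<R> (Red e u)) us es \<and> crwl \<Sigma> \<R> (Red (Fun f us) t)"
  then obtain us where us: "list_all2 (\<lambda>u e. crwl \<Sigma> \<R> (Red e u)) us es"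
    and red: "crwl \<Sigma> \<R> (Red (Fun f us) t)" by blast
  have args: "us \<in> args \<Sigma> f"
    using us es(1) crwl_Red_TermB(2)[OF assms(1)]
    by (fastforce simp: args_def list_all2_conv_all_nth in_set_conv_nth)
  \<comment> \<open>An instance that matches \<open>us\<close> has patterns below \<open>us\<close>,
    and downward closure makes them reducts of \<open>es\<close>, so it applies to the original
    call.\<close>
  have "list_all2 (\<lambda>e t. crwl \<Sigma> \<R> (Red e t)) es ss" if "list_all2 (approx \<Sigma>) ss us" for ss
    using us that crwl_down_closed[OF assms(1)] by (auto simp: list_all2_conv_all_nth)
  then show "crwl \<Sigma> \<R> (Red (Fun f es) t)"
    using red unfolding crwl_Fun_args_iff[OF assms(1) args f] crwl_Fun_iff[OF assms] by blast
qed

section \<open>Cones, evaluation in an arbitrary term algebra, and the operator on term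
  algebras\<close>

lemma mem_eval_Var: "t \<in> eval \<Sigma> A \<eta> (Var x) \<longleftrightarrow> approx \<Sigma> t (\<eta> x)"
  by (auto simp: down_def dest: approx_CTermB)

lemma mem_eval_Bot: "t \<in> eval \<Sigma> A \<eta> Bot \<longleftrightarrow> t = Bot"
  by (auto simp: down_def)

lemma mem_eval_Con: "t \<in> eval \<Sigma> A \<eta> (Con c es) \<longleftrightarrow>
    (\<exists>us. list_all2 (\<lambda>u e. u \<in> eval \<Sigma> A \<eta> e) us es \<and> approx \<Sigma> t (Con c us))"
  by (auto simp: con_interp_def down_def list_all2_map2 dest: approx_CTermB)

lemma mem_eval_Fun: "t \<in> eval \<Sigma> A \<eta> (Fun f es) \<longleftrightarrow>
    (\<exists>us. list_all2 (\<lambda>u e. u \<in> eval \<Sigma> A \<eta> e) us es \<and> t \<in> A f us)"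
  by (auto simp: list_all2_map2)

text \<open>Elementwise form of evaluation, suited to comparison with provability. The recursion
  equations then leave the simplifier so that they do not unfold the left-hand sides of these
  equivalences.\<close>

lemmas mem_eval = mem_eval_Var mem_eval_Bot mem_eval_Con mem_eval_Fun

declare eval.simps [simp del]

lemma TAlg_cone:
  "A \<in> TAlg \<Sigma> \<Longrightarrow> f \<in> FS \<Sigma> \<Longrightarrow> ts \<in> args \<Sigma> f \<Longrightarrow> A f ts \<in> cones \<Sigma>"
  by (auto simp: TAlg_def PiE_iff)

lemma TAlg_mono:
  "A \<in> TAlg \<Sigma> \<Longrightarrow> f \<in> FS \<Sigma> \<Longrightarrow> ss \<in> args \<Sigma> f \<Longrightarrow> ts \<in> args \<Sigma> f \<Longrightarrow>
    list_all2 (approx \<Sigma>) ss ts \<Longrightarrow> A f ss \<subseteq> A f ts"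
  by (auto simp: TAlg_def)

lemma cone_down_closed: "K \<in> cones \<Sigma> \<Longrightarrow> t \<in> K \<Longrightarrow> approx \<Sigma> s t \<Longrightarrow> s \<in> K"
  by (auto simp: cones_def dest: approx_CTermB)

lemma cone_Bot: "K \<in> cones \<Sigma> \<Longrightarrow> Bot \<in> K"
  by (fastforce simp: cones_def intro: approx.bot)

lemma cone_CTermB: "K \<in> cones \<Sigma> \<Longrightarrow> t \<in> K \<Longrightarrow> t \<in> CTermB \<Sigma>"
  by (auto simp: cones_def)

lemma conesI:
  assumes "Bot \<in> K" and "\<And>t. t \<in> K \<Longrightarrow> t \<in> CTermB \<Sigma>"
    and "\<And>s t. t \<in> K \<Longrightarrow> approx \<Sigma> s t \<Longrightarrow> s \<in> K"
  shows "K \<in> cones \<Sigma>"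
  using assms by (auto simp: cones_def)

lemma eval_args:
  assumes "list_all2 (\<lambda>u e. u \<in> eval \<Sigma> A \<eta> e) us es" and "length es = ar_fun \<Sigma> f"
    and "\<And>e. e \<in> set es \<Longrightarrow> eval \<Sigma> A \<eta> e \<subseteq> CTermB \<Sigma>"
  shows "us \<in> args \<Sigma> f"
  using assms by (fastforce simp: args_def list_all2_conv_all_nth in_set_conv_nth)

text \<open>Evaluation yields unions of cones, and such unions are downward closed. Non-emptiness
  needs one admissible tuple of argument values: by induction every argument has the value
  \<open>Bot\<close>.\<close>

lemma eval_cone:
  assumes A: "A \<in> TAlg \<Sigma>" and \<eta>: "\<And>x. \<eta> x \<in> CTermB \<Sigma>" and "e \<in> TermB \<Sigma>"
  shows "eval \<Sigma> A \<eta> e \<in> cones \<Sigma>"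
  using assms(3)
proof (induction e rule: trm.induct)
  case (Var x)
  show ?case
  proof (rule conesI)
    show "Bot \<in> eval \<Sigma> A \<eta> (Var x)" using \<eta> by (simp add: mem_eval approx.bot)
  qed (use approx_CTermB approx.trans in \<open>unfold mem_eval, blast+\<close>)
next
  case Bot
  show ?case by (rule conesI) (auto simp: mem_eval)
next
  case (Con c es)
  have es: "length es = ar_con \<Sigma> c" "c \<in> DS \<Sigma>"
    and IH: "\<And>e. e \<in> set es \<Longrightarrow> eval \<Sigma> A \<eta> e \<in> cones \<Sigma>"
    using Con by (auto simp: Con_TermB)
  let ?us = "replicate (length es) Bot"
  have us: "list_all2 (\<lambda>u e. u \<in> eval \<Sigma> A \<eta> e) ?us es"
    using cone_Bot[OF IH] by (simp add: list_all2_conv_all_nth)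
  have "Con c ?us \<in> CTermB \<Sigma>" using es by (auto simp: Con_CTermB)
  then have Bot: "Bot \<in> eval \<Sigma> A \<eta> (Con c es)"
    using us approx.bot unfolding mem_eval by blast
  show ?case
    by (rule conesI[OF Bot]) (use approx_CTermB approx.trans in \<open>unfold mem_eval, blast+\<close>)
next
  case (Fun f es)
  have f: "f \<in> FS \<Sigma>" and es: "length es = ar_fun \<Sigma> f" and
    IH: "\<And>e. e \<in> set es \<Longrightarrow> eval \<Sigma> A \<eta> e \<in> cones \<Sigma>"
    using Fun by (auto simp: Fun_TermB)
  have cone: "A f us \<in> cones \<Sigma>" if "list_all2 (\<lambda>u e. u \<in> eval \<Sigma> A \<eta> e) us es" for us
    using eval_args[OF that es] cone_CTermB[OF IH] by (intro TAlg_cone[OF A f]) blast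
  let ?us = "replicate (length es) Bot"
  have us: "list_all2 (\<lambda>u e. u \<in> eval \<Sigma> A \<eta> e) ?us es"
    using cone_Bot[OF IH] by (simp add: list_all2_conv_all_nth)
  then have Bot: "Bot \<in> eval \<Sigma> A \<eta> (Fun f es)"
    using cone_Bot[OF cone] unfolding mem_eval by blast
  show ?case
    by (rule conesI[OF Bot])
      (use cone_CTermB[OF cone] cone_down_closed[OF cone] in \<open>unfold mem_eval, blast+\<close>)
qed

text \<open>The interpretation of function symbols is never consulted here, so in every algebra a
  constructor term denotes its own down-set. This parallels \<open>crwl_CTermB_iff\<close>.\<close>

lemma eval_Var_CTermB:
  assumes "t \<in> CTermB \<Sigma>"
  shows "s \<in> eval \<Sigma> A Var t \<longleftrightarrow> approx \<Sigma> s t"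
  using assms
proof (induction t arbitrary: s)
  case (Con c ts)
  have ts: "set ts \<subseteq> CTermB \<Sigma>" using Con.prems by (simp add: Con_CTermB)
  have "list_all2 (\<lambda>u e. u \<in> eval \<Sigma> A Var e) us ts \<longleftrightarrow> list_all2 (approx \<Sigma>) us ts" for us
    using Con.IH ts by (auto simp: list_all2_conv_all_nth subset_iff)
  moreover have "approx \<Sigma> (Con c us) (Con c ts)" if "list_all2 (approx \<Sigma>) us ts" for us
    using that Con.prems by (simp add: approx_Con_iff)
  ultimately show ?case
    using approx_refl_list[OF ts] by (auto simp: mem_eval intro: approx.trans)
qed (auto simp: mem_eval)

text \<open>Each value is a union of denotations of right-hand sides, which are cones, with
  \<open>Bot\<close> added so that it is non-empty even if no instance applies. Monotonicity is
  transitivity of \<sqsubseteq>: an instance matching smaller arguments also matches larger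
  ones.\<close>

lemma T_op_TAlg:
  assumes "is_program \<Sigma> \<R>" and "A \<in> TAlg \<Sigma>"
  shows "T_op \<Sigma> \<R> A \<in> TAlg \<Sigma>"
proof -
  have cone: "eval \<Sigma> A Var r \<in> cones \<Sigma>" if "Rule f ss r C \<in> instances \<Sigma> \<R>" for f ss r C
    using instance_TermB(3)[OF assms(1) that] by (intro eval_cone[OF assms(2)]) auto
  have "T_op \<Sigma> \<R> A f ts \<in> cones \<Sigma>" if "f \<in> FS \<Sigma>" "ts \<in> args \<Sigma> f" for f ts
  proof (rule conesI)
    show "Bot \<in> T_op \<Sigma> \<R> A f ts" using that by (simp add: T_op_def)
    show "t \<in> CTermB \<Sigma>" if "t \<in> T_op \<Sigma> \<R> A f ts" for t
      using that \<open>f \<in> FS \<Sigma>\<close> \<open>ts \<in> args \<Sigma> f\<close> cone_CTermB[OF cone] by (auto simp: T_op_def)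
    show "s \<in> T_op \<Sigma> \<R> A f ts" if "t \<in> T_op \<Sigma> \<R> A f ts" "approx \<Sigma> s t" for s t
    \<comment> \<open>The element \<open>Bot\<close> may stem from the added singleton, with no
      instance at hand; below it there is only itself.\<close>
    proof (cases "t = Bot")
      case False
      then show ?thesis
        using that \<open>f \<in> FS \<Sigma>\<close> \<open>ts \<in> args \<Sigma> f\<close> cone_down_closed[OF cone]
        by (simp add: T_op_def) blast
    qed (use that in simp)
  qed
  moreover have "T_op \<Sigma> \<R> A f ss \<subseteq> T_op \<Sigma> \<R> A f ts"
    if "f \<in> FS \<Sigma>" "ss \<in> args \<Sigma> f" "ts \<in> args \<Sigma> f" "list_all2 (approx \<Sigma>) ss ts" for f ss ts
    using that(1-3) approx_trans_list[OF _ that(4)] by (simp add: T_op_def) blast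
  moreover have "T_op \<Sigma> \<R> A \<in> extensional (FS \<Sigma>)"
    "\<And>f. f \<in> FS \<Sigma> \<Longrightarrow> T_op \<Sigma> \<R> A f \<in> extensional (args \<Sigma> f)"
    by (auto simp: T_op_def)
  ultimately show ?thesis by (auto simp: TAlg_def PiE_def)
qed

section \<open>The algebra \<open>M_alg\<close>: its membership in \<open>TAlg\<close>, its
  denotations and the fixpoint equation\<close>

lemma mem_M_alg:
  assumes "is_program \<Sigma> \<R>" and "f \<in> FS \<Sigma>" and "ts \<in> args \<Sigma> f"
  shows "t \<in> M_alg \<Sigma> \<R> f ts \<longleftrightarrow> crwl \<Sigma> \<R> (Red (Fun f ts) t)"
  using assms crwl_Red_TermB(2)[OF assms(1)] by (auto simp: M_alg_def)

lemma M_alg_TAlg: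
  assumes "is_program \<Sigma> \<R>"
  shows "M_alg \<Sigma> \<R> \<in> TAlg \<Sigma>"
proof -
  have "M_alg \<Sigma> \<R> f ts \<in> cones \<Sigma>" if "f \<in> FS \<Sigma>" "ts \<in> args \<Sigma> f" for f ts
  proof -
    have "Bot \<in> M_alg \<Sigma> \<R> f ts"
      using that by (simp add: mem_M_alg[OF assms] crwl_Fun_args_iff[OF assms])
    moreover have "M_alg \<Sigma> \<R> f ts \<subseteq> CTermB \<Sigma>" using that by (auto simp: M_alg_def)
    ultimately show ?thesis
      using that by (auto simp: cones_def mem_M_alg[OF assms] intro: crwl_down_closed[OF assms])
  qed
  moreover have "M_alg \<Sigma> \<R> f ss \<subseteq> M_alg \<Sigma> \<R> f ts"
    if "f \<in> FS \<Sigma>" "ss \<in> args \<Sigma> f" "ts \<in> args \<Sigma> f" "list_all2 (approx \<Sigma>) ss ts" for f ss ts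
  proof
    fix t assume "t \<in> M_alg \<Sigma> \<R> f ss"
    then show "t \<in> M_alg \<Sigma> \<R> f ts"
      using that(1-3) approx_trans_list[OF _ that(4)]
      unfolding mem_M_alg[OF assms that(1,2)] mem_M_alg[OF assms that(1,3)]
        crwl_Fun_args_iff[OF assms that(2,1)] crwl_Fun_args_iff[OF assms that(3,1)]
      by blast
  qed
  moreover have "M_alg \<Sigma> \<R> \<in> extensional (FS \<Sigma>)"
    "\<And>f. f \<in> FS \<Sigma> \<Longrightarrow> M_alg \<Sigma> \<R> f \<in> extensional (args \<Sigma> f)"
    by (auto simp: M_alg_def)
  ultimately show ?thesis by (auto simp: TAlg_def PiE_def)
qed

text \<open>Constructor applications match through \<open>DS\<close>, with downward closure
  accounting for the down-set in \<open>con_interp\<close>. Function applications match through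
  \<open>crwl_Fun_via_CTermB\<close>, since \<open>M_alg\<close> records exactly the provable calls
  on constructor terms.\<close>

lemma eval_M_alg:
  assumes "is_program \<Sigma> \<R>" and "e \<in> TermB \<Sigma>"
  shows "t \<in> eval \<Sigma> (M_alg \<Sigma> \<R>) Var e \<longleftrightarrow> crwl \<Sigma> \<R> (Red e t)"
  using assms(2)
proof (induction e arbitrary: t rule: trm.induct)
  case (Con c es)
  have c: "c \<in> DS \<Sigma>" and es: "length es = ar_con \<Sigma> c" "set es \<subseteq> TermB \<Sigma>"
    using Con.prems by (simp_all add: Con_TermB)
  have IH: "list_all2 (\<lambda>u e. u \<in> eval \<Sigma> (M_alg \<Sigma> \<R>) Var e) us es \<longleftrightarrow>
      list_all2 (\<lambda>e u. crwl \<Sigma> \<R> (Red e u)) es us" for us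
    using Con.IH es(2) by (auto simp: list_all2_conv_all_nth subset_iff)
  have DS: "crwl \<Sigma> \<R> (Red (Con c es) (Con c us))"
    if "list_all2 (\<lambda>e u. crwl \<Sigma> \<R> (Red e u)) es us" for us
    using c es(1) that by (rule crwl.DS)
  show ?case
  proof
    assume "t \<in> eval \<Sigma> (M_alg \<Sigma> \<R>) Var (Con c es)"
    then show "crwl \<Sigma> \<R> (Red (Con c es) t)"
      using DS crwl_down_closed[OF assms(1)] by (auto simp: mem_eval IH)
  next
    assume red: "crwl \<Sigma> \<R> (Red (Con c es) t)"
    then show "t \<in> eval \<Sigma> (M_alg \<Sigma> \<R>) Var (Con c es)"
    proof (cases rule: crwl_Con_cases)
      case 1
      then show ?thesis
        using cone_Bot[OF eval_cone[OF M_alg_TAlg[OF assms(1)] Var_CTermB Con.prems]] by simp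
    next
      case (2 ts)
      then show ?thesis
        using crwl_Red_TermB(2)[OF assms(1) red] by (auto simp: mem_eval IH intro: approx.refl)
    qed
  qed
next
  case (Fun f es)
  have f: "f \<in> FS \<Sigma>" and es: "length es = ar_fun \<Sigma> f" "set es \<subseteq> TermB \<Sigma>"
    using Fun.prems by (simp_all add: Fun_TermB)
  have IH: "list_all2 (\<lambda>u e. u \<in> eval \<Sigma> (M_alg \<Sigma> \<R>) Var e) us es \<longleftrightarrow>
      list_all2 (\<lambda>u e. crwl \<Sigma> \<R> (Red e u)) us es" for us
    using Fun.IH es(2) by (auto simp: list_all2_conv_all_nth subset_iff)
  have "us \<in> args \<Sigma> f" if "list_all2 (\<lambda>u e. crwl \<Sigma> \<R> (Red e u)) us es" for us
    using that es(1) crwl_Red_TermB(2)[OF assms(1)]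
    by (fastforce simp: args_def list_all2_conv_all_nth in_set_conv_nth)
  then show ?case
    using mem_M_alg[OF assms(1) f]
    by (auto simp: mem_eval IH crwl_Fun_via_CTermB[OF assms(1) Fun.prems])
qed (auto simp: mem_eval approx_Var_iff crwl_CTermB_iff[OF assms(1)])

lemma crwl_Join_iff:
  "crwl \<Sigma> \<R> (Join a b) \<longleftrightarrow> (\<exists>t\<in>CTerm \<Sigma>. crwl \<Sigma> \<R> (Red a t) \<and> crwl \<Sigma> \<R> (Red b t))"
  by (auto elim: crwl_JoinE intro: crwl.Jo)

text \<open>The maximal common value demanded by \<open>models\<close> is the common reduct without
  \<open>Bot\<close> demanded by \<open>Jo\<close>, because the maximal elements are the members of
  \<open>CTerm\<close>.\<close>

lemma models_M_alg:
  assumes "is_program \<Sigma> \<R>" and "C \<subseteq> TermB \<Sigma> \<times> TermB \<Sigma>"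
  shows "models \<Sigma> (M_alg \<Sigma> \<R>) Var C \<longleftrightarrow> (\<forall>(a, b)\<in>C. crwl \<Sigma> \<R> (Join a b))"
  unfolding models_def
proof (rule ball_cong[OF HOL.refl])
  fix p assume "p \<in> C"
  then obtain a b where p: "p = (a, b)" and "a \<in> TermB \<Sigma>" "b \<in> TermB \<Sigma>"
    using assms(2) by auto
  then show "(case p of (a, b) \<Rightarrow> \<exists>t. t \<in> eval \<Sigma> (M_alg \<Sigma> \<R>) Var a \<inter> eval \<Sigma> (M_alg \<Sigma> \<R>) Var b \<and>
      is_maximal \<Sigma> t) \<longleftrightarrow> (case p of (a, b) \<Rightarrow> crwl \<Sigma> \<R> (Join a b))"
    by (auto simp: p eval_M_alg[OF assms(1)] is_maximal_iff_CTerm crwl_Join_iff)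
qed

lemma T_op_M_alg:
  assumes "is_program \<Sigma> \<R>"
  shows "T_op \<Sigma> \<R> (M_alg \<Sigma> \<R>) = M_alg \<Sigma> \<R>"
proof -
  have "T_op \<Sigma> \<R> (M_alg \<Sigma> \<R>) f ts = M_alg \<Sigma> \<R> f ts" if "f \<in> FS \<Sigma>" "ts \<in> args \<Sigma> f" for f ts
  proof -
    \<comment> \<open>The equivalence relies on well-formedness of \<open>r\<close> and
      \<open>C\<close> and is therefore stated for instances only; below, \<open>conj_cong\<close>
      makes membership in \<open>instances\<close> available while rewriting.\<close>
    have "models \<Sigma> (M_alg \<Sigma> \<R>) Var C \<and> t \<in> eval \<Sigma> (M_alg \<Sigma> \<R>) Var r \<longleftrightarrow>
        (\<forall>(a, b)\<in>C. crwl \<Sigma> \<R> (Join a b)) \<and> crwl \<Sigma> \<R> (Red r t)"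
      if "Rule f ss r C \<in> instances \<Sigma> \<R>" for ss r C t
      using instance_TermB(3,4)[OF assms that]
      by (simp add: models_M_alg[OF assms] eval_M_alg[OF assms])
    then have "t \<in> T_op \<Sigma> \<R> (M_alg \<Sigma> \<R>) f ts \<longleftrightarrow> crwl \<Sigma> \<R> (Red (Fun f ts) t)" for t
      unfolding crwl_Fun_args_iff[OF assms that(2,1)] using that
      by (simp add: T_op_def cong: conj_cong)
    then show ?thesis by (simp add: set_eq_iff mem_M_alg[OF assms that])
  qed
  \<comment> \<open>Outside \<open>FS \<Sigma>\<close> and \<open>args \<Sigma> f\<close> both sides
    are \<open>undefined\<close>, so agreement on legal arguments is equality.\<close>
  then show ?thesis
    by (intro ext) (simp add: M_alg_def T_op_def restrict_def)
qed

section \<open>Soundness of the calculus in pre-fixpoints, and leastness of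
  \<open>M_alg\<close>\<close>

lemma crwl_sound:
  assumes "is_program \<Sigma> \<R>" and A: "A \<in> TAlg \<Sigma>" and pre: "alg_le \<Sigma> (T_op \<Sigma> \<R> A) A"
    and "crwl \<Sigma> \<R> (Red e t)"
  shows "t \<in> eval \<Sigma> A Var e"
proof -
  \<comment> \<open>Here joinability needs its real meaning, since the conditions of an
    \<open>OR\<close> step must hold in \<open>A\<close> before the operator can use the
    instance.\<close>
  have "case \<phi> of Red e t \<Rightarrow> t \<in> eval \<Sigma> A Var e
      | Join a b \<Rightarrow> \<exists>t. t \<in> eval \<Sigma> A Var a \<inter> eval \<Sigma> A Var b \<and> is_maximal \<Sigma> t"
    if "crwl \<Sigma> \<R> \<phi>" for \<phi>
    using that
  proof (induction rule: crwl.induct)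
    case (Bo e)
    then show ?case using cone_Bot[OF eval_cone[OF A Var_CTermB]] by simp
  next
    case (RR e)
    then have "e \<in> CTermB \<Sigma>" by (auto simp: Con_CTermB)
    then show ?case by (simp add: eval_Var_CTermB approx.refl)
  next
    case (DS c es ts)
    have red: "crwl \<Sigma> \<R> (Red (Con c es) (Con c ts))"
      using DS by (auto intro!: crwl.DS elim!: list_all2_mono)
    have "list_all2 (\<lambda>u e. u \<in> eval \<Sigma> A Var e) ts es"
      using DS.IH by (simp add: list_all2_conv_all_nth)
    then show ?case
      using approx.refl[OF crwl_Red_TermB(2)[OF assms(1) red]] by (auto simp: mem_eval)
  next
    case (OR f ts r C es t)
    note inst = instance_TermB[OF assms(1) OR.hyps(1)]
    have "list_all2 (\<lambda>u e. u \<in> eval \<Sigma> A Var e) ts es"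
      using OR.IH(1) by (simp add: list_all2_conv_all_nth)
    moreover have "models \<Sigma> A Var C"
      using OR.IH(2) by (auto simp: models_def)
    \<comment> \<open>The instance is applied at its own patterns \<open>ts\<close>, which are also
      values of the arguments \<open>es\<close>. The pre-fixpoint property then carries
      \<open>t\<close> from the operator's result into \<open>A\<close>.\<close>
    then have "t \<in> T_op \<Sigma> \<R> A f ts"
      using OR.hyps(1) OR.IH(3) inst approx_refl_list[of ts \<Sigma>]
      by (auto simp: T_op_def args_def)
    then have "t \<in> A f ts" using pre inst by (auto simp: alg_le_def)
    ultimately show ?case by (auto simp: mem_eval)
  next
    case (Jo a t b)
    then show ?case by (auto simp: is_maximal_iff_CTerm)
  qed
  from this[OF assms(4)] show ?thesis by simp
qed

lemma M_alg_least:
  assumes "is_program \<Sigma> \<R>" and A: "A \<in> TAlg \<Sigma>" and pre: "alg_le \<Sigma> (T_op \<Sigma> \<R> A) A"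
  shows "alg_le \<Sigma> (M_alg \<Sigma> \<R>) A"
  unfolding alg_le_def
proof (intro ballI subsetI)
  fix f ts t assume f: "f \<in> FS \<Sigma>" and ts: "ts \<in> args \<Sigma> f" and "t \<in> M_alg \<Sigma> \<R> f ts"
  then have "t \<in> eval \<Sigma> A Var (Fun f ts)"
    using crwl_sound[OF assms] by (simp add: mem_M_alg[OF assms(1)])
  then obtain us where us: "list_all2 (\<lambda>u e. u \<in> eval \<Sigma> A Var e) us ts" and t: "t \<in> A f us"
    by (auto simp: mem_eval)
  \<comment> \<open>Values of constructor arguments only approximate these arguments, so
    \<open>t\<close> lies in \<open>A\<close> at a possibly smaller tuple; monotonicity of
    \<open>A\<close> transfers it to \<open>ts\<close>.\<close>
  have le: "list_all2 (approx \<Sigma>) us ts"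
    using us ts by (auto simp: args_def list_all2_conv_all_nth eval_Var_CTermB subset_iff)
  then have "us \<in> args \<Sigma> f"
    using ts by (auto simp: args_def list_all2_conv_all_nth in_set_conv_nth)
      (use approx_CTermB in blast)
  then show "t \<in> A f ts" using TAlg_mono[OF A f _ ts le] t by blast
qed

theorem proposition3p6:
  fixes \<Sigma> :: "('c, 'f) signature"
    and \<R> :: "('c, 'f, 'v::countable) rule set"
  assumes "is_signature \<Sigma>"
    and "is_program \<Sigma> \<R>"
  shows "T_op \<Sigma> \<R> \<in> TAlg \<Sigma> \<rightarrow> TAlg \<Sigma> \<and>
    M_alg \<Sigma> \<R> \<in> TAlg \<Sigma> \<and>
    (T_op \<Sigma> \<R> (M_alg \<Sigma> \<R>) = M_alg \<Sigma> \<R> \<and>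
      (\<forall>A\<in>TAlg \<Sigma>. T_op \<Sigma> \<R> A = A \<longrightarrow> alg_le \<Sigma> (M_alg \<Sigma> \<R>) A)) \<and>
    (alg_le \<Sigma> (T_op \<Sigma> \<R> (M_alg \<Sigma> \<R>)) (M_alg \<Sigma> \<R>) \<and>
      (\<forall>A\<in>TAlg \<Sigma>. alg_le \<Sigma> (T_op \<Sigma> \<R> A) A \<longrightarrow> alg_le \<Sigma> (M_alg \<Sigma> \<R>) A))"
proof -
  \<comment> \<open>Reflexivity makes every fixpoint a pre-fixpoint, so leastness among
    pre-fixpoints settles both claims.\<close>
  have refl: "alg_le \<Sigma> A A" for A :: "('c, 'f, 'v) algebra" by (simp add: alg_le_def)
  show ?thesis
    using T_op_TAlg[OF assms(2)] M_alg_TAlg[OF assms(2)] T_op_M_alg[OF assms(2)]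
      M_alg_least[OF assms(2)] refl by auto
qed

end
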